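(* Let $\beta_1,\beta_2\in\mathbb{R}$. If the generalized real quaternion algebra $\mathbb{H}(\beta_1,\beta_2)$ is a division algebra, then there is a natural number $n'$ such that for all $n\ge n'$ the Clifford algebra $C(\mathcal{H}_n^{\mathbb{R}})$ associated to the real vector space $\mathcal{H}_n^{\mathbb{R}}$ (equipped with the quadratic form $q_{\mathcal{H}_n^{\mathbb{R}}}$) is isomorphic, as an $\mathbb{R}$-algebra, to the split quaternion algebra $\mathbb{H}(-1,-1)$.
   Context: For $\beta_1,\beta_2\in\mathbb{R}$, $\mathbb{H}(\beta_1,\beta_2)$ denotes the generalized real quaternion algebra: the unital associative $\mathbb{R}$-algebra with basis $\{1,e_2,e_3,e_4\}$ and multiplication $e_2^2=-\beta_1$, $e_3^2=-\beta_2$, $e_4^2=-\beta_1\beta_2$, $e_2e_3=e_4=-e_3e_2$, $e_2e_4=-\beta_1e_3=-e_4e_2$, $e_3e_4=\beta_2e_2=-e_4e_3$. The norm of $a=a_1\cdot 1+a_2e_2+a_3e_3+a_4e_4$ is $\mathbf{n}(a)=a_1^2+\beta_1a_2^2+\beta_2a_3^2+\beta_1\beta_2a_4^2$. (A split quaternion algebra is one that is not a division algebra.) The Fibonacci numbers are $f_0=0$, $f_1=1$, $f_n=f_{n-1}+f_{n-2}$ for $n\ge 2$. The $n$th Fibonacci quaternion is $F_n=f_n\cdot 1+f_{n+1}e_2+f_{n+2}e_3+f_{n+3}e_4\in\mathbb{H}(\beta_1,\beta_2)$. For $p,q\in\mathbb{R}$, the $n$th generalized Fibonacci quaternion is $H_n^{p,q}=pF_n+qF_{n+1}$,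 and $\mathcal{H}_n^{\mathbb{R}}=\{H_n^{p,q} : p,q\in\mathbb{R}\}\cup\{0\}$, a real vector space of dimension two with basis $\{F_n,F_{n+1}\}$. It is equipped with the quadratic form $q_{\mathcal{H}_n^{\mathbb{R}}}:\mathcal{H}_n^{\mathbb{R}}\to\mathbb{R}$, $$q_{\mathcal{H}_n^{\mathbb{R}}}(x_1F_n+x_2F_{n+1})=\mathbf{n}(F_n)x_1^2+\mathbf{n}(F_{n+1})x_2^2 .$$ The Clifford algebra of a real vector space $V$ with quadratic form $q$ is $C(V,q)=T(V)/\mathcal{J}$, where $T(V)$ is the tensor algebra and $\mathcal{J}$ is the two-sided ideal generated by all $x\otimes x-q(x)\cdot 1$, $x\in V$. Here $C(\mathcal{H}_n^{\mathbb{R}})=C(\mathcal{H}_n^{\mathbb{R}},q_{\mathcal{H}_n^{\mathbb{R}}})$. *)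

theory Defs
  imports
    "HOL-Analysis.Analysis"
    "HOL-Algebra.QuotRing"
    "HOL-Algebra.Module"
    "HOL-Number_Theory.Fib"
    "HOL-Library.Poly_Mapping"
begin

section \<open>Real algebras as records\<close>

text \<open>
  A real algebra is represented by the library record \<^type>\<open>module\<close>, i.e. a ring with an additional
  scalar multiplication. The library locale \<^locale>\<open>algebra\<close> is not usable here, since it
  requires the algebra to be commutative.
\<close>

definition algebra_isomorphic ::
    "('k, 'a) module \<Rightarrow> ('k, 'b) module \<Rightarrow> bool"  (infixl \<open>\<simeq>\<^sub>a\<close> 50) where
  "A \<simeq>\<^sub>a B \<longleftrightarrow>
     (\<exists>h \<in> ring_iso A B. \<forall>r. \<forall>x \<in> carrier A. h (r \<odot>\<^bsub>A\<^esub> x) = r \<odot>\<^bsub>B\<^esub> h x)"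

definition division_algebra :: "('k, 'a) module \<Rightarrow> bool" where
  "division_algebra A \<longleftrightarrow> ring A \<and> \<one>\<^bsub>A\<^esub> \<noteq> \<zero>\<^bsub>A\<^esub> \<and> carrier A - {\<zero>\<^bsub>A\<^esub>} \<subseteq> Units A"

text \<open>The library's quotient ring, with the induced scalar multiplication
  \<open>r (I + x) = I + r x\<close>.\<close>

definition quotient_algebra :: "('k, 'a) module \<Rightarrow> 'a set \<Rightarrow> ('k, 'a set) module" where
  "quotient_algebra A I =
     \<lparr>carrier = carrier (A Quot I), mult = mult (A Quot I), one = one (A Quot I),
      zero = zero (A Quot I), add = add (A Quot I),
      smult = (\<lambda>r X. \<Union>x\<in>X. I +>\<^bsub>A\<^esub> (r \<odot>\<^bsub>A\<^esub> x))\<rparr>"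


section \<open>Tensor algebra and Clifford algebra\<close>

text \<open>Words form a monoid under concatenation, so that the convolution product which
  \<^theory>\<open>HOL-Library.Poly_Mapping\<close> puts on finitely supported functions
  on words is the product of the free associative algebra.\<close>

instantiation list :: (type) monoid_add
begin

definition zero_list :: "'a list" where "0 = []"
definition plus_list :: "'a list \<Rightarrow> 'a list \<Rightarrow> 'a list" where "xs + ys = xs @ ys"

instance by standard (simp_all add: zero_list_def plus_list_def)

end

text \<open>The free associative unital real algebra on the underlying set of \<open>V\<close>. Its elements are the
  formal linear combinations of words over \<open>V\<close>; the degree \<open>k\<close> part is the
  free vector space on the set \<open>V\<^sup>k\<close>.\<close>

definition free_algebra :: "'a set \<Rightarrow> (real, 'a list \<Rightarrow>\<^sub>0 real) module" where
  "free_algebra V =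
     \<lparr>carrier = {f. Poly_Mapping.keys f \<subseteq> lists V}, mult = (*), one = 1, zero = 0, add = (+),
      smult = (\<lambda>r f. Poly_Mapping.single [] r * f)\<rparr>"

text \<open>The ideal generated by these elements is the span of the multilinearity relations
  \<open>u\<otimes>(ax+by)\<otimes>w - a (u\<otimes>x\<otimes>w) - b (u\<otimes>y\<otimes>w)\<close> in all degrees. It is homogeneous, and
  the degree \<open>k\<close> part of the quotient is the tensor power \<open>V\<otimes>\<cdots>\<otimes>V\<close> (\<open>k\<close> factors).\<close>

definition linearity_relations :: "'a::real_vector set \<Rightarrow> ('a list \<Rightarrow>\<^sub>0 real) set" where
  "linearity_relations V =
     {Poly_Mapping.single [a *\<^sub>R x + b *\<^sub>R y] 1
        - Poly_Mapping.single [x] a - Poly_Mapping.single [y] b | a b x y. x \<in> V \<and> y \<in> V}"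

definition tensor_ideal :: "'a::real_vector set \<Rightarrow> ('a list \<Rightarrow>\<^sub>0 real) set" where
  "tensor_ideal V = Idl\<^bsub>free_algebra V\<^esub> linearity_relations V"

definition tensor_algebra :: "'a::real_vector set \<Rightarrow> (real, ('a list \<Rightarrow>\<^sub>0 real) set) module" where
  "tensor_algebra V = quotient_algebra (free_algebra V) (tensor_ideal V)"

definition tensor_inclusion :: "'a::real_vector set \<Rightarrow> 'a \<Rightarrow> ('a list \<Rightarrow>\<^sub>0 real) set" where
  "tensor_inclusion V x = tensor_ideal V +>\<^bsub>free_algebra V\<^esub> Poly_Mapping.single [x] 1"

definition clifford_ideal ::
    "'a::real_vector set \<Rightarrow> ('a \<Rightarrow> real) \<Rightarrow> ('a list \<Rightarrow>\<^sub>0 real) set set" where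
  "clifford_ideal V q =
     Idl\<^bsub>tensor_algebra V\<^esub>
       {tensor_inclusion V x \<otimes>\<^bsub>tensor_algebra V\<^esub> tensor_inclusion V x
          \<ominus>\<^bsub>tensor_algebra V\<^esub> q x \<odot>\<^bsub>tensor_algebra V\<^esub> \<one>\<^bsub>tensor_algebra V\<^esub> | x. x \<in> V}"

definition clifford_algebra ::
    "'a::real_vector set \<Rightarrow> ('a \<Rightarrow> real) \<Rightarrow> (real, ('a list \<Rightarrow>\<^sub>0 real) set set) module" where
  "clifford_algebra V q = quotient_algebra (tensor_algebra V) (clifford_ideal V q)"


section \<open>Generalized real quaternion algebras\<close>

text \<open>Coordinates are taken with respect to the basis \<open>1, e\<^sub>2, e\<^sub>3, e\<^sub>4\<close>. The product is the bilinear
  extension of the multiplication table, which is recovered below.\<close>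

definition quat_mult :: "real \<Rightarrow> real \<Rightarrow> real^4 \<Rightarrow> real^4 \<Rightarrow> real^4" where
  "quat_mult \<beta>\<^sub>1 \<beta>\<^sub>2 a b = vector
     [a$1 * b$1 - \<beta>\<^sub>1 * (a$2 * b$2) - \<beta>\<^sub>2 * (a$3 * b$3) - \<beta>\<^sub>1 * \<beta>\<^sub>2 * (a$4 * b$4),
      a$1 * b$2 + a$2 * b$1 + \<beta>\<^sub>2 * (a$3 * b$4) - \<beta>\<^sub>2 * (a$4 * b$3),
      a$1 * b$3 + a$3 * b$1 - \<beta>\<^sub>1 * (a$2 * b$4) + \<beta>\<^sub>1 * (a$4 * b$2),
      a$1 * b$4 + a$4 * b$1 + a$2 * b$3 - a$3 * b$2]"

definition quaternion_algebra :: "real \<Rightarrow> real \<Rightarrow> (real, real^4) module" where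
  "quaternion_algebra \<beta>\<^sub>1 \<beta>\<^sub>2 =
     \<lparr>carrier = UNIV, mult = quat_mult \<beta>\<^sub>1 \<beta>\<^sub>2, one = axis 1 1, zero = 0, add = (+),
      smult = (*\<^sub>R)\<rparr>"

definition quat_norm :: "real \<Rightarrow> real \<Rightarrow> real^4 \<Rightarrow> real" where
  "quat_norm \<beta>\<^sub>1 \<beta>\<^sub>2 a = (a$1)\<^sup>2 + \<beta>\<^sub>1 * (a$2)\<^sup>2 + \<beta>\<^sub>2 * (a$3)\<^sup>2 + \<beta>\<^sub>1 * \<beta>\<^sub>2 * (a$4)\<^sup>2"


section \<open>Generalized Fibonacci quaternions\<close>

definition fib_quat :: "nat \<Rightarrow> real^4" where
  "fib_quat n = vector [real (fib n), real (fib (n+1)), real (fib (n+2)), real (fib (n+3))]"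

definition gen_fib_quat :: "real \<Rightarrow> real \<Rightarrow> nat \<Rightarrow> real^4" where
  "gen_fib_quat p q n = p *\<^sub>R fib_quat n + q *\<^sub>R fib_quat (n+1)"

definition fib_space :: "nat \<Rightarrow> (real^4) set" where
  "fib_space n = {gen_fib_quat p q n | p q. True} \<union> {0}"

text \<open>This is the diagonal form in the basis \<open>F\<^sub>n, F\<^sub>n\<^sub>+\<^sub>1\<close>, which differs from the restriction of the
  quaternion norm in general.\<close>

definition fib_form :: "real \<Rightarrow> real \<Rightarrow> nat \<Rightarrow> real^4 \<Rightarrow> real" where
  "fib_form \<beta>\<^sub>1 \<beta>\<^sub>2 n v =
     (THE r. \<exists>x\<^sub>1 x\<^sub>2. v = x\<^sub>1 *\<^sub>R fib_quat n + x\<^sub>2 *\<^sub>R fib_quat (n+1) \<and>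
        r = quat_norm \<beta>\<^sub>1 \<beta>\<^sub>2 (fib_quat n) * x\<^sub>1\<^sup>2 + quat_norm \<beta>\<^sub>1 \<beta>\<^sub>2 (fib_quat (n+1)) * x\<^sub>2\<^sup>2)"


section \<open>Well-definedness\<close>

lemma vector_4 [simp]:
  "(vector [a, b, c, d] :: 'a::zero^4) $ 1 = a"
  "(vector [a, b, c, d] :: 'a::zero^4) $ 2 = b"
  "(vector [a, b, c, d] :: 'a::zero^4) $ 3 = c"
  "(vector [a, b, c, d] :: 'a::zero^4) $ 4 = d"
  by (simp_all add: vector_def)

lemma quat_mult_table:
  defines "e \<equiv> (\<lambda>i. axis i 1 :: real^4)"
  shows "quat_mult \<beta>\<^sub>1 \<beta>\<^sub>2 (e 1) a = a" "quat_mult \<beta>\<^sub>1 \<beta>\<^sub>2 a (e 1) = a"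
    and "quat_mult \<beta>\<^sub>1 \<beta>\<^sub>2 (e 2) (e 2) = (- \<beta>\<^sub>1) *\<^sub>R e 1"
    and "quat_mult \<beta>\<^sub>1 \<beta>\<^sub>2 (e 3) (e 3) = (- \<beta>\<^sub>2) *\<^sub>R e 1"
    and "quat_mult \<beta>\<^sub>1 \<beta>\<^sub>2 (e 4) (e 4) = (- (\<beta>\<^sub>1 * \<beta>\<^sub>2)) *\<^sub>R e 1"
    and "quat_mult \<beta>\<^sub>1 \<beta>\<^sub>2 (e 2) (e 3) = e 4" "quat_mult \<beta>\<^sub>1 \<beta>\<^sub>2 (e 3) (e 2) = - e 4"
    and "quat_mult \<beta>\<^sub>1 \<beta>\<^sub>2 (e 2) (e 4) = (- \<beta>\<^sub>1) *\<^sub>R e 3" "quat_mult \<beta>\<^sub>1 \<beta>\<^sub>2 (e 4) (e 2) = \<beta>\<^sub>1 *\<^sub>R e 3"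
    and "quat_mult \<beta>\<^sub>1 \<beta>\<^sub>2 (e 3) (e 4) = \<beta>\<^sub>2 *\<^sub>R e 2" "quat_mult \<beta>\<^sub>1 \<beta>\<^sub>2 (e 4) (e 3) = (- \<beta>\<^sub>2) *\<^sub>R e 2"
  by (simp_all add: e_def quat_mult_def vec_eq_iff forall_4 axis_def)

lemma ring_quaternion_algebra: "ring (quaternion_algebra \<beta>\<^sub>1 \<beta>\<^sub>2)"
proof (rule ringI)
  show "abelian_group (quaternion_algebra \<beta>\<^sub>1 \<beta>\<^sub>2)"
    by (rule abelian_groupI)
      (auto simp: quaternion_algebra_def algebra_simps intro: exI [of _ "- _"] left_minus)
  show "Group.monoid (quaternion_algebra \<beta>\<^sub>1 \<beta>\<^sub>2)"
    by (rule monoidI)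
      (simp_all add: quaternion_algebra_def quat_mult_table,
       simp add: quat_mult_def vec_eq_iff forall_4 algebra_simps)
qed (simp_all add: quaternion_algebra_def quat_mult_def vec_eq_iff forall_4 algebra_simps)

lemma not_division_algebra_split: "\<not> division_algebra (quaternion_algebra (-1) (-1))"
proof
  assume *: "division_algebra (quaternion_algebra (-1) (-1))"
  define x y :: "real^4" where "x = vector [1, 1, 0, 0]" and "y = vector [1, -1, 0, 0]"
  have nz: "x \<noteq> 0" "y \<noteq> 0"
    by (simp_all add: x_def y_def vec_eq_iff forall_4)
  interpret Q: ring "quaternion_algebra (-1) (-1)"
    by (rule ring_quaternion_algebra)
  have "x \<in> Units (quaternion_algebra (-1) (-1))"
    using * nz by (auto simp: division_algebra_def quaternion_algebra_def)
  moreover have "x \<otimes>\<^bsub>quaternion_algebra (-1) (-1)\<^esub> y = \<zero>\<^bsub>quaternion_algebra (-1) (-1)\<^esub>"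
    by (simp add: quaternion_algebra_def quat_mult_def x_def y_def vec_eq_iff forall_4)
  moreover have "y \<in> carrier (quaternion_algebra (-1) (-1))"
    by (simp add: quaternion_algebra_def)
  ultimately have "y = \<zero>\<^bsub>quaternion_algebra (-1) (-1)\<^esub>"
    by (metis Q.Units_closed Q.Units_l_cancel Q.r_null Q.zero_closed)
  then show False
    using nz by (simp add: quaternion_algebra_def)
qed

lemma ring_free_algebra: "ring (free_algebra V)"
proof (rule ringI)
  show "abelian_group (free_algebra V)"
  proof (rule abelian_groupI)
    fix f assume "f \<in> carrier (free_algebra V)"
    then show "\<exists>g\<in>carrier (free_algebra V). g \<oplus>\<^bsub>free_algebra V\<^esub> f = \<zero>\<^bsub>free_algebra V\<^esub>"
      by (intro bexI [of _ "- f"]) (auto simp: free_algebra_def)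
  qed (use Poly_Mapping.keys_add in \<open>fastforce simp: free_algebra_def algebra_simps\<close>)+
  show "Group.monoid (free_algebra V)"
  proof (rule monoidI)
    fix f g assume "f \<in> carrier (free_algebra V)" "g \<in> carrier (free_algebra V)"
    then show "f \<otimes>\<^bsub>free_algebra V\<^esub> g \<in> carrier (free_algebra V)"
      using keys_mult [of f g] by (fastforce simp: free_algebra_def plus_list_def)
  qed (auto simp: free_algebra_def mult.assoc zero_list_def)
qed (auto simp: free_algebra_def algebra_simps)

lemma linearity_relations_carrier:
  assumes "subspace V"
  shows "linearity_relations V \<subseteq> carrier (free_algebra V)"
proof
  fix f assume "f \<in> linearity_relations V"
  then obtain a b x y where V: "x \<in> V" "y \<in> V" and
    f: "f = Poly_Mapping.single [a *\<^sub>R x + b *\<^sub>R y] 1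
        - Poly_Mapping.single [x] a - Poly_Mapping.single [y] b"
    unfolding linearity_relations_def by blast
  have "Poly_Mapping.keys f \<subseteq> {[a *\<^sub>R x + b *\<^sub>R y], [x], [y]}"
    unfolding f by (auto simp: in_keys_iff lookup_minus lookup_single when_def split: if_splits)
  moreover have "a *\<^sub>R x + b *\<^sub>R y \<in> V"
    using assms V by (simp add: subspace_add subspace_scale)
  ultimately show "f \<in> carrier (free_algebra V)"
    using V by (auto simp: free_algebra_def)
qed

lemma ring_quotient_algebra:
  assumes "ideal I A"
  shows "ring (quotient_algebra A I)"
proof -
  interpret Q: ring "A Quot I"
    by (rule ideal.quotient_is_ring [OF assms])
  show ?thesis
  proof (rule ringI)
    show "abelian_group (quotient_algebra A I)"
    proof (rule abelian_groupI)
      fix X assume "X \<in> carrier (quotient_algebra A I)"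
      then show "\<exists>Y\<in>carrier (quotient_algebra A I).
          Y \<oplus>\<^bsub>quotient_algebra A I\<^esub> X = \<zero>\<^bsub>quotient_algebra A I\<^esub>"
        by (intro bexI [of _ "\<ominus>\<^bsub>A Quot I\<^esub> X"]) (simp_all add: quotient_algebra_def Q.l_neg)
    qed (simp_all add: quotient_algebra_def Q.a_ac)
    show "Group.monoid (quotient_algebra A I)"
      by (rule monoidI) (simp_all add: quotient_algebra_def Q.m_assoc)
  qed (simp_all add: quotient_algebra_def Q.l_distr Q.r_distr)
qed

lemma ideal_tensor_ideal:
  assumes "subspace V"
  shows "ideal (tensor_ideal V) (free_algebra V)"
  unfolding tensor_ideal_def
  by (rule ring.genideal_ideal [OF ring_free_algebra linearity_relations_carrier [OF assms]])

lemma smult_tensor_algebra: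
  assumes "subspace V" "f \<in> carrier (free_algebra V)"
  shows "r \<odot>\<^bsub>tensor_algebra V\<^esub> (tensor_ideal V +>\<^bsub>free_algebra V\<^esub> f)
       = tensor_ideal V +>\<^bsub>free_algebra V\<^esub> (r \<odot>\<^bsub>free_algebra V\<^esub> f)"
proof -
  let ?F = "free_algebra V" and ?I = "tensor_ideal V"
  interpret ideal ?I ?F by (rule ideal_tensor_ideal [OF assms(1)])
  have sc: "Poly_Mapping.single [] r \<in> carrier ?F"
    by (simp add: free_algebra_def)
  have sm: "r \<odot>\<^bsub>?F\<^esub> g = Poly_Mapping.single [] r \<otimes>\<^bsub>?F\<^esub> g" for g
    by (simp add: free_algebra_def)
  have eq: "?I +>\<^bsub>?F\<^esub> (r \<odot>\<^bsub>?F\<^esub> g) = ?I +>\<^bsub>?F\<^esub> (r \<odot>\<^bsub>?F\<^esub> f)" if g: "g \<in> ?I +>\<^bsub>?F\<^esub> f" for g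
  proof -
    from g obtain i where i: "i \<in> ?I" "g = i \<oplus>\<^bsub>?F\<^esub> f"
      by (auto simp: a_r_coset_def')
    then have "r \<odot>\<^bsub>?F\<^esub> g = r \<odot>\<^bsub>?F\<^esub> i \<oplus>\<^bsub>?F\<^esub> r \<odot>\<^bsub>?F\<^esub> f"
      by (simp add: free_algebra_def distrib_left)
    moreover have "r \<odot>\<^bsub>?F\<^esub> i \<in> ?I"
      unfolding sm using I_l_closed [OF i(1) sc] .
    moreover have "r \<odot>\<^bsub>?F\<^esub> f \<in> carrier ?F"
      unfolding sm using sc assms(2) by simp
    ultimately have "r \<odot>\<^bsub>?F\<^esub> g \<in> ?I +>\<^bsub>?F\<^esub> (r \<odot>\<^bsub>?F\<^esub> f)"
      by (auto simp: a_r_coset_def')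
    then show ?thesis
      using a_repr_independence \<open>r \<odot>\<^bsub>?F\<^esub> f \<in> carrier ?F\<close>
      by (metis additive_subgroup.a_subgroup additive_subgroup_axioms)
  qed
  have "f \<in> ?I +>\<^bsub>?F\<^esub> f"
    using a_rcos_self assms(2) by blast
  then have "(\<Union>g\<in>?I +>\<^bsub>?F\<^esub> f. ?I +>\<^bsub>?F\<^esub> (r \<odot>\<^bsub>?F\<^esub> g)) = ?I +>\<^bsub>?F\<^esub> (r \<odot>\<^bsub>?F\<^esub> f)"
    by (intro SUP_eq_const eq) blast+
  then show ?thesis
    by (simp only: tensor_algebra_def quotient_algebra_def module.simps)
qed

lemma fib_quat_independent:
  assumes "x\<^sub>1 *\<^sub>R fib_quat n + x\<^sub>2 *\<^sub>R fib_quat (n+1) = y\<^sub>1 *\<^sub>R fib_quat n + y\<^sub>2 *\<^sub>R fib_quat (n+1)"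
  shows "x\<^sub>1 = y\<^sub>1 \<and> x\<^sub>2 = y\<^sub>2"
  using assms
proof (induction n arbitrary: x\<^sub>1 x\<^sub>2 y\<^sub>1 y\<^sub>2)
  case 0
  then show ?case
    by (simp add: fib_quat_def vec_eq_iff forall_4 numeral_eq_Suc)
next
  case (Suc n)
  have rec: "fib_quat (Suc n + 1) = fib_quat n + fib_quat (n+1)"
    by (simp add: fib_quat_def vec_eq_iff forall_4 numeral_eq_Suc)
  have "x\<^sub>2 *\<^sub>R fib_quat n + (x\<^sub>1 + x\<^sub>2) *\<^sub>R fib_quat (n+1)
      = y\<^sub>2 *\<^sub>R fib_quat n + (y\<^sub>1 + y\<^sub>2) *\<^sub>R fib_quat (n+1)"
    using Suc.prems unfolding rec by (simp add: algebra_simps)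
  from Suc.IH [OF this] show ?case by simp
qed

lemma fib_form_coordinates:
  "fib_form \<beta>\<^sub>1 \<beta>\<^sub>2 n (x\<^sub>1 *\<^sub>R fib_quat n + x\<^sub>2 *\<^sub>R fib_quat (n+1)) =
     quat_norm \<beta>\<^sub>1 \<beta>\<^sub>2 (fib_quat n) * x\<^sub>1\<^sup>2 + quat_norm \<beta>\<^sub>1 \<beta>\<^sub>2 (fib_quat (n+1)) * x\<^sub>2\<^sup>2"
  unfolding fib_form_def by (rule the_equality) (use fib_quat_independent in blast)+

lemma fib_space_eq_span: "fib_space n = span {fib_quat n, fib_quat (n+1)}"
proof -
  have "fib_space n = {p *\<^sub>R fib_quat n + q *\<^sub>R fib_quat (n+1) | p q. True}"
    unfolding fib_space_def gen_fib_quat_def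
    by (auto intro: exI [of _ "0::real"])
  also have "\<dots> = span {fib_quat n, fib_quat (n+1)}"
    by (auto simp: span_insert span_singleton algebra_simps)
  finally show ?thesis .
qed

end

theory Submission
  imports Defs
begin

text \<open>
  If \<open>\<beta>\<^sub>1 \<le> 0\<close>, then \<open>\<surd>(-\<beta>\<^sub>1) + e\<^sub>2\<close> and its conjugate are nonzero elements with product \<open>0\<close>, and
  similarly for \<open>\<beta>\<^sub>2\<close>. So if \<open>H(\<beta>\<^sub>1, \<beta>\<^sub>2)\<close> is a division algebra, then both parameters are positive
  (\<open>division_quaternion_algebra_pos\<close>) and the quaternion norm is a positive definite form. In
  particular every \<open>F\<^sub>n\<close> has positive norm, and \<open>n' = 0\<close> can be taken.

  The algebraic core is that the Clifford algebra of the binary form \<open>a s\<^sup>2 + b t\<^sup>2\<close> is the quaternion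
  algebra \<open>H(-a, -b)\<close>, for arbitrary real \<open>a\<close> and \<open>b\<close>: the basis vectors go to \<open>e\<^sub>2\<close> and \<open>e\<^sub>3\<close>, which
  square to \<open>a\<close> and \<open>b\<close> and anticommute (\<open>binary_diagonal_form.clifford_algebra_isomorphic\<close>). If
  \<open>a\<close> and \<open>b\<close> are positive, dividing \<open>e\<^sub>2\<close> and \<open>e\<^sub>3\<close> by \<open>\<surd>a\<close> and \<open>\<surd>b\<close> turns \<open>H(-a, -b)\<close> into
  \<open>H(-1, -1)\<close> (\<open>quaternion_algebra_rescale\<close>).

  Since the Clifford algebra is an iterated quotient of the free algebra \<open>\<real>\<langle>V\<rangle>\<close>, the isomorphism is
  obtained by comparing kernels of maps out of \<open>\<real>\<langle>V\<rangle>\<close>. One map is the projection onto the Clifford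
  algebra; its kernel is the ideal generated by the linearity relations together with the relations
  \<open>x x = q(x)\<close> (\<open>clifford_projection_eq_zero_iff\<close>). The other is the evaluation of words
  in \<open>H(-a, -b)\<close>. It kills these relations. Conversely, the basis \<open>1, x, y, x y\<close> gives
  a linear section of the evaluation, and every element of \<open>\<real>\<langle>V\<rangle>\<close> agrees with the section
  of its value modulo the relations (\<open>eval_lift_congruent\<close>), so anything that evaluates to \<open>0\<close> lies in
  the ideal.
\<close>

section \<open>Quotients and isomorphisms of real algebras\<close>

lemma coset_ring_hom:
  assumes "ideal I A"
  shows "(+>\<^bsub>A\<^esub>) I \<in> ring_hom A (quotient_algebra A I)"
  using ideal.rcos_ring_hom [OF assms] by (simp add: ring_hom_def quotient_algebra_def)

lemma carrier_quotient_algebra: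
  "carrier (quotient_algebra A I) = (+>\<^bsub>A\<^esub>) I ` carrier A"
  by (auto simp: quotient_algebra_def FactRing_def A_RCOSETS_def')

lemma coset_eq_zero_iff:
  assumes "ideal I A" "x \<in> carrier A"
  shows "I +>\<^bsub>A\<^esub> x = \<zero>\<^bsub>quotient_algebra A I\<^esub> \<longleftrightarrow> x \<in> I"
proof -
  interpret ideal I A by fact
  show ?thesis
    using rcos_const_imp_mem [OF assms(2)] a_rcos_const [of x]
    by (auto simp: quotient_algebra_def FactRing_def)
qed

text \<open>Scalar multiplication on a quotient is defined as a union over representatives. It is a single coset because
  \<open>r\<close> acts as multiplication by a ring element \<open>c\<close>, and \<open>(I + c) (I + f) = I + c f\<close> does not depend
  on the representatives.\<close>

lemma smult_quotient_algebra:
  assumes "ideal I A" "f \<in> carrier A" "c \<in> carrier A"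
    and smult: "\<And>g. g \<in> carrier A \<Longrightarrow> r \<odot>\<^bsub>A\<^esub> g = c \<otimes>\<^bsub>A\<^esub> g"
  shows "r \<odot>\<^bsub>quotient_algebra A I\<^esub> (I +>\<^bsub>A\<^esub> f) = I +>\<^bsub>A\<^esub> (r \<odot>\<^bsub>A\<^esub> f)"
proof -
  interpret ideal I A by fact
  have eq: "I +>\<^bsub>A\<^esub> (r \<odot>\<^bsub>A\<^esub> g) = I +>\<^bsub>A\<^esub> (r \<odot>\<^bsub>A\<^esub> f)" if "g \<in> I +>\<^bsub>A\<^esub> f" for g
  proof -
    have g: "g \<in> carrier A"
      using that assms(2) a_elemrcos_carrier by blast
    have "I +>\<^bsub>A\<^esub> g = I +>\<^bsub>A\<^esub> f"
      using a_repr_independence that assms(2) a_subgroup by metis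
    then show ?thesis
      using rcoset_mult_add [OF assms(3) g] rcoset_mult_add [OF assms(3) assms(2)]
      by (simp add: smult g assms(2))
  qed
  have "f \<in> I +>\<^bsub>A\<^esub> f"
    using a_rcos_self assms(2) by blast
  then have "(\<Union>g\<in>I +>\<^bsub>A\<^esub> f. I +>\<^bsub>A\<^esub> (r \<odot>\<^bsub>A\<^esub> g)) = I +>\<^bsub>A\<^esub> (r \<odot>\<^bsub>A\<^esub> f)"
    by (intro SUP_eq_const eq) blast+
  then show ?thesis
    by (simp add: quotient_algebra_def)
qed

lemma ideal_quotient_algebra_image:
  assumes "ideal I A" "ideal K A"
  shows "ideal ((+>\<^bsub>A\<^esub>) I ` K) (quotient_algebra A I)"
proof -
  interpret J: ideal "(+>\<^bsub>A\<^esub>) I ` K" "A Quot I"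
    using ring.ring_ideal_imp_quot_ideal [OF ideal.axioms(2) [OF assms(1)] assms] .
  show ?thesis
  proof (rule idealI [OF ring_quotient_algebra [OF assms(1)]])
    show "subgroup ((+>\<^bsub>A\<^esub>) I ` K) (add_monoid (quotient_algebra A I))"
      using J.a_subgroup by (simp add: subgroup_def m_inv_def quotient_algebra_def)
  qed (use J.I_l_closed J.I_r_closed in \<open>simp_all add: quotient_algebra_def\<close>)
qed

lemma algebra_isomorphic_trans:
  assumes "A \<simeq>\<^sub>a B" "B \<simeq>\<^sub>a C"
  shows "A \<simeq>\<^sub>a C"
proof -
  obtain f g where fg: "f \<in> ring_iso A B" "g \<in> ring_iso B C"
    and f: "\<And>r x. x \<in> carrier A \<Longrightarrow> f (r \<odot>\<^bsub>A\<^esub> x) = r \<odot>\<^bsub>B\<^esub> f x"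
    and g: "\<And>r x. x \<in> carrier B \<Longrightarrow> g (r \<odot>\<^bsub>B\<^esub> x) = r \<odot>\<^bsub>C\<^esub> g x"
    using assms unfolding algebra_isomorphic_def by blast
  show ?thesis
    unfolding algebra_isomorphic_def
    using ring_iso_set_trans [OF fg] f g ring_iso_memE(1) [OF fg(1)]
    by (intro bexI [of _ "g \<circ> f"]) auto
qed

lemma ring_hom_eq_iff_diff:
  assumes "ring A" "ring B" "h \<in> ring_hom A B" "x \<in> carrier A" "y \<in> carrier A"
  shows "h x = h y \<longleftrightarrow> h (x \<ominus>\<^bsub>A\<^esub> y) = \<zero>\<^bsub>B\<^esub>"
proof -
  interpret h: ring_hom_ring A B h
    by (rule ring_hom_ringI2) fact+
  have "h (x \<ominus>\<^bsub>A\<^esub> y) = h x \<ominus>\<^bsub>B\<^esub> h y"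
    using assms by (simp add: a_minus_def)
  then show ?thesis
    using ring_hom_closed [OF assms(3)] assms(4,5)
    by (metis a_minus_def h.S.add.inv_closed h.S.minus_equality h.S.r_neg)
qed

text \<open>Both targets are \<open>A\<close> modulo the common kernel. This form of the first isomorphism theorem
  suits iterated quotients, which are not literally of the form \<open>A Quot I\<close>.\<close>

lemma algebra_isomorphic_if_common_kernel:
  assumes rings: "ring A" "ring B" "ring C"
    and f: "f \<in> ring_hom A B" "f ` carrier A = carrier B"
      "\<And>r x. x \<in> carrier A \<Longrightarrow> f (r \<odot>\<^bsub>A\<^esub> x) = r \<odot>\<^bsub>B\<^esub> f x"
    and g: "g \<in> ring_hom A C" "g ` carrier A = carrier C"
      "\<And>r x. x \<in> carrier A \<Longrightarrow> g (r \<odot>\<^bsub>A\<^esub> x) = r \<odot>\<^bsub>C\<^esub> g x"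
    and smult: "\<And>r x. x \<in> carrier A \<Longrightarrow> r \<odot>\<^bsub>A\<^esub> x \<in> carrier A"
    and kernel: "\<And>x. x \<in> carrier A \<Longrightarrow> f x = \<zero>\<^bsub>B\<^esub> \<longleftrightarrow> g x = \<zero>\<^bsub>C\<^esub>"
  shows "B \<simeq>\<^sub>a C"
proof -
  interpret A: ring A by fact
  have same_fibres: "f x = f y \<longleftrightarrow> g x = g y" if "x \<in> carrier A" "y \<in> carrier A" for x y
    using that kernel [of "x \<ominus>\<^bsub>A\<^esub> y"] ring_hom_eq_iff_diff [OF rings(1,2) f(1)]
      ring_hom_eq_iff_diff [OF rings(1,3) g(1)] by simp
  define s where "s = inv_into (carrier A) f"
  have s: "s b \<in> carrier A" "f (s b) = b" if "b \<in> carrier B" for b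
    using that f(2) by (auto simp: s_def inv_into_into f_inv_into_f)
  have gs: "g (s (f x)) = g x" if "x \<in> carrier A" for x
    using that s [of "f x"] same_fibres [of "s (f x)" x] f(2) by auto
  have "g \<circ> s \<in> ring_iso B C"
  proof (rule ring_iso_memI)
    fix x y assume x: "x \<in> carrier B" and y: "y \<in> carrier B"
    note sxy = s [OF x] s [OF y]
    show "(g \<circ> s) x \<in> carrier C"
      using sxy g(2) by auto
    show "(g \<circ> s) (x \<otimes>\<^bsub>B\<^esub> y) = (g \<circ> s) x \<otimes>\<^bsub>C\<^esub> (g \<circ> s) y"
      using gs [of "s x \<otimes>\<^bsub>A\<^esub> s y"] ring_hom_mult [OF f(1)] ring_hom_mult [OF g(1)] sxy by simp
    show "(g \<circ> s) (x \<oplus>\<^bsub>B\<^esub> y) = (g \<circ> s) x \<oplus>\<^bsub>C\<^esub> (g \<circ> s) y"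
      using gs [of "s x \<oplus>\<^bsub>A\<^esub> s y"] ring_hom_add [OF f(1)] ring_hom_add [OF g(1)] sxy by simp
  next
    show "(g \<circ> s) \<one>\<^bsub>B\<^esub> = \<one>\<^bsub>C\<^esub>"
      using gs [of "\<one>\<^bsub>A\<^esub>"] ring_hom_one [OF f(1)] ring_hom_one [OF g(1)] by simp
    have "inj_on (g \<circ> s) (carrier B)"
      by (rule inj_onI) (metis comp_apply s same_fibres)
    moreover have "(g \<circ> s) ` carrier B = g ` carrier A"
      using s gs f(2) by force
    ultimately show "bij_betw (g \<circ> s) (carrier B) (carrier C)"
      by (simp add: bij_betw_def g(2))
  qed
  moreover have "(g \<circ> s) (r \<odot>\<^bsub>B\<^esub> x) = r \<odot>\<^bsub>C\<^esub> (g \<circ> s) x" if "x \<in> carrier B" for r x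
    using gs [of "r \<odot>\<^bsub>A\<^esub> s x"] f(3) g(3) s [OF that] smult by simp
  ultimately show ?thesis
    unfolding algebra_isomorphic_def by blast
qed

section \<open>The Clifford algebra as a quotient of the free algebra\<close>

lemma free_algebra_simps:
  "\<one>\<^bsub>free_algebra V\<^esub> = 1" "\<zero>\<^bsub>free_algebra V\<^esub> = 0"
  "f \<otimes>\<^bsub>free_algebra V\<^esub> g = f * g" "f \<oplus>\<^bsub>free_algebra V\<^esub> g = f + g"
  "r \<odot>\<^bsub>free_algebra V\<^esub> f = Poly_Mapping.single [] r * f"
  by (simp_all add: free_algebra_def)

lemma single_in_free_algebra: "w \<in> lists V \<Longrightarrow> Poly_Mapping.single w r \<in> carrier (free_algebra V)"
  by (simp add: free_algebra_def)

lemma smult_free_algebra_closed: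
  "f \<in> carrier (free_algebra V) \<Longrightarrow> r \<odot>\<^bsub>free_algebra V\<^esub> f \<in> carrier (free_algebra V)"
  using monoid.m_closed [OF ring.is_monoid [OF ring_free_algebra]] single_in_free_algebra [of "[]" V r]
  by (simp add: free_algebra_simps)

lemma minus_free_algebra:
  assumes "f \<in> carrier (free_algebra V)" "g \<in> carrier (free_algebra V)"
  shows "f \<ominus>\<^bsub>free_algebra V\<^esub> g = f - g"
proof -
  interpret ring "free_algebra V" by (rule ring_free_algebra)
  have "- g \<in> carrier (free_algebra V)"
    using assms by (simp add: free_algebra_def)
  then have "\<ominus>\<^bsub>free_algebra V\<^esub> g = - g"
    using assms(2) by (intro minus_equality) (simp_all add: free_algebra_simps)
  then show ?thesis
    by (simp add: a_minus_def free_algebra_simps)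
qed

lemma diff_free_algebra_closed:
  "f \<in> carrier (free_algebra V) \<Longrightarrow> g \<in> carrier (free_algebra V)
    \<Longrightarrow> f - g \<in> carrier (free_algebra V)"
  using abelian_group.minus_closed [OF ring.is_abelian_group [OF ring_free_algebra]]
  by (metis minus_free_algebra)

text \<open>The relations are stated in the free algebra and not in the tensor algebra, so that the Clifford
  algebra can be presented as a single quotient.\<close>

definition clifford_relations ::
    "'a::real_vector set \<Rightarrow> ('a \<Rightarrow> real) \<Rightarrow> ('a list \<Rightarrow>\<^sub>0 real) set" where
  "clifford_relations V q = linearity_relations V \<union>
     {Poly_Mapping.single [x, x] 1 - Poly_Mapping.single [] (q x) | x. x \<in> V}"

definition clifford_projection ::
    "'a::real_vector set \<Rightarrow> ('a \<Rightarrow> real) \<Rightarrow> ('a list \<Rightarrow>\<^sub>0 real) \<Rightarrow> ('a list \<Rightarrow>\<^sub>0 real) set set" where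
  "clifford_projection V q f =
     clifford_ideal V q +>\<^bsub>tensor_algebra V\<^esub> (tensor_ideal V +>\<^bsub>free_algebra V\<^esub> f)"

lemma clifford_relations_carrier:
  assumes "subspace V"
  shows "clifford_relations V q \<subseteq> carrier (free_algebra V)"
proof -
  have "Poly_Mapping.single [x, x] 1 - Poly_Mapping.single [] (q x) \<in> carrier (free_algebra V)"
    if "x \<in> V" for x
    using that by (intro diff_free_algebra_closed single_in_free_algebra) auto
  then show ?thesis
    using linearity_relations_carrier [OF assms] by (auto simp: clifford_relations_def)
qed

context
  fixes V :: "'a::real_vector set"
  assumes V: "subspace V"
begin

interpretation F: ring "free_algebra V" by (rule ring_free_algebra)

lemma tensor_projection_hom:
  "(+>\<^bsub>free_algebra V\<^esub>) (tensor_ideal V) \<in> ring_hom (free_algebra V) (tensor_algebra V)"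
  unfolding tensor_algebra_def by (rule coset_ring_hom [OF ideal_tensor_ideal [OF V]])

lemma ring_tensor_algebra: "ring (tensor_algebra V)"
  unfolding tensor_algebra_def by (rule ring_quotient_algebra [OF ideal_tensor_ideal [OF V]])

interpretation T: ring_hom_ring "free_algebra V" "tensor_algebra V" "(+>\<^bsub>free_algebra V\<^esub>) (tensor_ideal V)"
  by (rule ring_hom_ringI2 [OF ring_free_algebra ring_tensor_algebra tensor_projection_hom])

text \<open>This lifts the quadratic relations, which are imposed in the tensor algebra, to the free algebra.\<close>

lemma clifford_generator:
  assumes "x \<in> V"
  shows "tensor_inclusion V x \<otimes>\<^bsub>tensor_algebra V\<^esub> tensor_inclusion V x
          \<ominus>\<^bsub>tensor_algebra V\<^esub> r \<odot>\<^bsub>tensor_algebra V\<^esub> \<one>\<^bsub>tensor_algebra V\<^esub>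
       = tensor_ideal V +>\<^bsub>free_algebra V\<^esub>
           (Poly_Mapping.single [x, x] 1 - Poly_Mapping.single [] r)"
proof -
  have x: "Poly_Mapping.single [x] 1 \<in> carrier (free_algebra V)"
      "Poly_Mapping.single [x, x] 1 \<in> carrier (free_algebra V)"
    and r: "Poly_Mapping.single [] r \<in> carrier (free_algebra V)"
    using assms by (simp_all add: single_in_free_algebra)
  have "Poly_Mapping.single [x, x] 1
      = Poly_Mapping.single [x] (1::real) \<otimes>\<^bsub>free_algebra V\<^esub> Poly_Mapping.single [x] 1"
    by (simp add: free_algebra_simps mult_single plus_list_def)
  then have xx: "Poly_Mapping.single [x, x] 1 - Poly_Mapping.single [] r
      = Poly_Mapping.single [x] 1 \<otimes>\<^bsub>free_algebra V\<^esub> Poly_Mapping.single [x] 1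
          \<ominus>\<^bsub>free_algebra V\<^esub> Poly_Mapping.single [] r"
    using minus_free_algebra [OF x(2) r] by simp
  have "r \<odot>\<^bsub>tensor_algebra V\<^esub> \<one>\<^bsub>tensor_algebra V\<^esub>
      = tensor_ideal V +>\<^bsub>free_algebra V\<^esub> Poly_Mapping.single [] r"
    using smult_tensor_algebra [OF V F.one_closed, of r] by (simp add: free_algebra_simps T.hom_one [simplified free_algebra_simps])
  then show ?thesis
    using x r by (simp add: tensor_inclusion_def xx a_minus_def)
qed

lemma ideal_clifford_ideal: "ideal (clifford_ideal V q) (tensor_algebra V)"
  unfolding clifford_ideal_def
proof (rule ring.genideal_ideal [OF ring_tensor_algebra])
  show "{tensor_inclusion V x \<otimes>\<^bsub>tensor_algebra V\<^esub> tensor_inclusion V x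
          \<ominus>\<^bsub>tensor_algebra V\<^esub> q x \<odot>\<^bsub>tensor_algebra V\<^esub> \<one>\<^bsub>tensor_algebra V\<^esub> | x. x \<in> V}
      \<subseteq> carrier (tensor_algebra V)"
    using clifford_relations_carrier [OF V, of q]
    by (auto simp: clifford_generator clifford_relations_def)
qed

lemma ring_clifford_algebra: "ring (clifford_algebra V q)"
  unfolding clifford_algebra_def by (rule ring_quotient_algebra [OF ideal_clifford_ideal])

lemma clifford_projection_hom:
  "clifford_projection V q \<in> ring_hom (free_algebra V) (clifford_algebra V q)"
  using ring_hom_trans [OF tensor_projection_hom coset_ring_hom [OF ideal_clifford_ideal]]
  by (simp add: clifford_algebra_def comp_def clifford_projection_def [abs_def])

lemma clifford_projection_surj:
  "clifford_projection V q ` carrier (free_algebra V) = carrier (clifford_algebra V q)"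
  by (simp add: clifford_projection_def [abs_def] clifford_algebra_def tensor_algebra_def
      carrier_quotient_algebra image_image)

lemma clifford_projection_smult:
  assumes "f \<in> carrier (free_algebra V)"
  shows "clifford_projection V q (r \<odot>\<^bsub>free_algebra V\<^esub> f)
       = r \<odot>\<^bsub>clifford_algebra V q\<^esub> clifford_projection V q f"
proof -
  let ?T = "tensor_algebra V" and ?p = "(+>\<^bsub>free_algebra V\<^esub>) (tensor_ideal V)"
  have r: "Poly_Mapping.single [] r \<in> carrier (free_algebra V)"
    by (simp add: single_in_free_algebra)
  have "r \<odot>\<^bsub>?T\<^esub> g = ?p (Poly_Mapping.single [] r) \<otimes>\<^bsub>?T\<^esub> g" if "g \<in> carrier ?T" for g
  proof -
    obtain g' where g': "g' \<in> carrier (free_algebra V)" "g = ?p g'"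
      using \<open>g \<in> carrier ?T\<close> by (auto simp: tensor_algebra_def carrier_quotient_algebra)
    then show ?thesis
      using T.hom_mult [OF r g'(1)] smult_tensor_algebra [OF V g'(1), of r]
      by (simp add: free_algebra_simps)
  qed
  from smult_quotient_algebra [OF ideal_clifford_ideal _ _ this, of "?p f" q] show ?thesis
    using assms r by (simp add: clifford_projection_def clifford_algebra_def smult_tensor_algebra [OF V])
qed

text \<open>The third isomorphism theorem at the level of kernels. For one inclusion, the image in the tensor
  algebra of the ideal of all relations is an ideal that contains the Clifford generators; for the
  other, the preimage of the Clifford ideal is an ideal that contains both kinds of relations.\<close>

lemma clifford_projection_eq_zero_iff:
  assumes f: "f \<in> carrier (free_algebra V)"
  shows "clifford_projection V q f = \<zero>\<^bsub>clifford_algebra V q\<^esub>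
     \<longleftrightarrow> f \<in> Idl\<^bsub>free_algebra V\<^esub> clifford_relations V q"
proof -
  let ?F = "free_algebra V" and ?T = "tensor_algebra V"
  let ?I = "Idl\<^bsub>?F\<^esub> clifford_relations V q" and ?p = "(+>\<^bsub>free_algebra V\<^esub>) (tensor_ideal V)"
  have I: "ideal ?I ?F" and gen: "clifford_relations V q \<subseteq> ?I"
    using F.genideal_ideal F.genideal_self clifford_relations_carrier [OF V, of q] by blast+
  have tensor_ideal_le: "tensor_ideal V \<subseteq> ?I"
    unfolding tensor_ideal_def
    using gen by (intro F.genideal_minimal I) (auto simp: clifford_relations_def)
  have "clifford_projection V q f = \<zero>\<^bsub>clifford_algebra V q\<^esub> \<longleftrightarrow> ?p f \<in> clifford_ideal V q"
    using coset_eq_zero_iff [OF ideal_clifford_ideal, of "?p f" q] f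
    by (simp add: clifford_projection_def clifford_algebra_def)
  also have "\<dots> \<longleftrightarrow> f \<in> ?I"
  proof
    assume "?p f \<in> clifford_ideal V q"
    moreover have "clifford_ideal V q \<subseteq> ?p ` ?I"
      unfolding clifford_ideal_def
    proof (rule ring.genideal_minimal [OF ring_tensor_algebra])
      show "ideal (?p ` ?I) ?T"
        unfolding tensor_algebra_def
        by (rule ideal_quotient_algebra_image [OF ideal_tensor_ideal [OF V] I])
    qed (use gen in \<open>auto simp: clifford_generator clifford_relations_def\<close>)
    ultimately obtain g where g: "g \<in> ?I" "?p f = ?p g"
      by blast
    have gF: "g \<in> carrier ?F"
      using g(1) I by (meson additive_subgroup.a_Hcarr ideal.axioms(1))
    have "?p (f \<ominus>\<^bsub>?F\<^esub> g) = \<zero>\<^bsub>?T\<^esub>"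
      using ring_hom_eq_iff_diff [OF ring_free_algebra ring_tensor_algebra tensor_projection_hom f gF] g(2)
      by simp
    then have "f \<ominus>\<^bsub>?F\<^esub> g \<in> ?I"
      using coset_eq_zero_iff [OF ideal_tensor_ideal [OF V], of "f \<ominus>\<^bsub>?F\<^esub> g"] f gF tensor_ideal_le
      by (auto simp: tensor_algebra_def)
    then have "f \<ominus>\<^bsub>?F\<^esub> g \<oplus>\<^bsub>?F\<^esub> g \<in> ?I"
      using I g(1) by (meson additive_subgroup.a_closed ideal.axioms(1))
    then show "f \<in> ?I"
      using f gF by (simp add: minus_free_algebra free_algebra_simps)
  next
    have "?p g \<in> clifford_ideal V q" if "g \<in> clifford_relations V q" for g
      using that unfolding clifford_relations_def
    proof
      assume "g \<in> linearity_relations V"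
      then have "g \<in> tensor_ideal V"
        unfolding tensor_ideal_def
        using F.genideal_self [OF linearity_relations_carrier [OF V]] by blast
      then have "?p g = \<zero>\<^bsub>?T\<^esub>"
        using coset_eq_zero_iff [OF ideal_tensor_ideal [OF V], of g]
          additive_subgroup.a_Hcarr [OF ideal.axioms(1) [OF ideal_tensor_ideal [OF V]]]
        by (auto simp: tensor_algebra_def)
      then show ?thesis
        using additive_subgroup.zero_closed [OF ideal.axioms(1) [OF ideal_clifford_ideal]] by simp
    next
      assume "g \<in> {Poly_Mapping.single [x, x] 1 - Poly_Mapping.single [] (q x) | x. x \<in> V}"
      then obtain x where x: "x \<in> V" "g = Poly_Mapping.single [x, x] 1 - Poly_Mapping.single [] (q x)"
        by blast
      have "?p g = tensor_inclusion V x \<otimes>\<^bsub>tensor_algebra V\<^esub> tensor_inclusion V x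
          \<ominus>\<^bsub>tensor_algebra V\<^esub> q x \<odot>\<^bsub>tensor_algebra V\<^esub> \<one>\<^bsub>tensor_algebra V\<^esub>"
        unfolding x(2) by (rule clifford_generator [OF x(1), symmetric])
      then show ?thesis
        using x(1) by (auto simp: clifford_ideal_def genideal_def)
    qed
    then have "?I \<subseteq> {g \<in> carrier ?F. ?p g \<in> clifford_ideal V q}"
      using clifford_relations_carrier [OF V, of q]
      by (intro F.genideal_minimal T.ideal_vimage ideal_clifford_ideal) auto
    then show "?p f \<in> clifford_ideal V q" if "f \<in> ?I"
      using that by blast
  qed
  finally show ?thesis .
qed

end

section \<open>Evaluation in quaternion algebras\<close>

lemma poly_mapping_induct_keys [consumes 1, case_names zero single add]:
  fixes f :: "'a \<Rightarrow>\<^sub>0 'b::comm_monoid_add"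
  assumes "Poly_Mapping.keys f \<subseteq> A"
    and "P 0"
    and single: "\<And>k c. k \<in> A \<Longrightarrow> P (Poly_Mapping.single k c)"
    and add: "\<And>f g. P f \<Longrightarrow> P g \<Longrightarrow> P (f + g)"
  shows "P f"
proof -
  have "f = (\<Sum>k\<in>Poly_Mapping.keys f. Poly_Mapping.single k (Poly_Mapping.lookup f k))"
    by (rule poly_mapping_eqI) (auto simp: lookup_sum lookup_single when_def in_keys_iff)
  moreover have "P (\<Sum>k\<in>S. Poly_Mapping.single k (Poly_Mapping.lookup f k))"
    if "finite S" "S \<subseteq> A" for S
    using that by (induction S rule: finite_induct) (auto intro: assms)
  ultimately show ?thesis
    using assms(1) finite_keys by metis
qed

definition quat_word :: "real \<Rightarrow> real \<Rightarrow> ('a \<Rightarrow> real^4) \<Rightarrow> 'a list \<Rightarrow> real^4" where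
  "quat_word \<beta>\<^sub>1 \<beta>\<^sub>2 \<psi> w = foldr (\<lambda>v. quat_mult \<beta>\<^sub>1 \<beta>\<^sub>2 (\<psi> v)) w (axis 1 1)"

definition quat_eval :: "real \<Rightarrow> real \<Rightarrow> ('a \<Rightarrow> real^4) \<Rightarrow> ('a list \<Rightarrow>\<^sub>0 real) \<Rightarrow> real^4" where
  "quat_eval \<beta>\<^sub>1 \<beta>\<^sub>2 \<psi> f =
     (\<Sum>w\<in>Poly_Mapping.keys f. Poly_Mapping.lookup f w *\<^sub>R quat_word \<beta>\<^sub>1 \<beta>\<^sub>2 \<psi> w)"

lemma quat_mult_assoc:
  "quat_mult \<beta>\<^sub>1 \<beta>\<^sub>2 (quat_mult \<beta>\<^sub>1 \<beta>\<^sub>2 a b) c = quat_mult \<beta>\<^sub>1 \<beta>\<^sub>2 a (quat_mult \<beta>\<^sub>1 \<beta>\<^sub>2 b c)"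
  using monoid.m_assoc [OF ring.is_monoid [OF ring_quaternion_algebra [of \<beta>\<^sub>1 \<beta>\<^sub>2]], of a b c]
  by (simp add: quaternion_algebra_def)

lemma bilinear_quat_mult: "bilinear (quat_mult \<beta>\<^sub>1 \<beta>\<^sub>2)"
  unfolding bilinear_def
  by (auto intro!: linearI simp: quat_mult_def vec_eq_iff forall_4 algebra_simps)

lemma quat_word_simps [simp]:
  "quat_word \<beta>\<^sub>1 \<beta>\<^sub>2 \<psi> [] = axis 1 1"
  "quat_word \<beta>\<^sub>1 \<beta>\<^sub>2 \<psi> (v # w) = quat_mult \<beta>\<^sub>1 \<beta>\<^sub>2 (\<psi> v) (quat_word \<beta>\<^sub>1 \<beta>\<^sub>2 \<psi> w)"
  by (simp_all add: quat_word_def)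

lemma quat_word_append:
  "quat_word \<beta>\<^sub>1 \<beta>\<^sub>2 \<psi> (v @ w)
     = quat_mult \<beta>\<^sub>1 \<beta>\<^sub>2 (quat_word \<beta>\<^sub>1 \<beta>\<^sub>2 \<psi> v) (quat_word \<beta>\<^sub>1 \<beta>\<^sub>2 \<psi> w)"
  by (induction v) (simp_all add: quat_mult_table quat_mult_assoc)

lemma quat_eval_single [simp]:
  "quat_eval \<beta>\<^sub>1 \<beta>\<^sub>2 \<psi> (Poly_Mapping.single w r) = r *\<^sub>R quat_word \<beta>\<^sub>1 \<beta>\<^sub>2 \<psi> w"
  by (simp add: quat_eval_def)

lemma quat_eval_zero [simp]: "quat_eval \<beta>\<^sub>1 \<beta>\<^sub>2 \<psi> 0 = 0"
  by (simp add: quat_eval_def)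

lemma quat_eval_add:
  "quat_eval \<beta>\<^sub>1 \<beta>\<^sub>2 \<psi> (f + g) = quat_eval \<beta>\<^sub>1 \<beta>\<^sub>2 \<psi> f + quat_eval \<beta>\<^sub>1 \<beta>\<^sub>2 \<psi> g"
  unfolding quat_eval_def by (rule setsum_keys_plus_distrib) (simp_all add: scaleR_add_left)

lemma quat_eval_diff:
  "quat_eval \<beta>\<^sub>1 \<beta>\<^sub>2 \<psi> (f - g) = quat_eval \<beta>\<^sub>1 \<beta>\<^sub>2 \<psi> f - quat_eval \<beta>\<^sub>1 \<beta>\<^sub>2 \<psi> g"
  using quat_eval_add [of \<beta>\<^sub>1 \<beta>\<^sub>2 \<psi> "f - g" g] by simp

lemma quat_eval_mult:
  "quat_eval \<beta>\<^sub>1 \<beta>\<^sub>2 \<psi> (f * g) = quat_mult \<beta>\<^sub>1 \<beta>\<^sub>2 (quat_eval \<beta>\<^sub>1 \<beta>\<^sub>2 \<psi> f) (quat_eval \<beta>\<^sub>1 \<beta>\<^sub>2 \<psi> g)"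
proof -
  note bl = bilinear_quat_mult [of \<beta>\<^sub>1 \<beta>\<^sub>2]
  note bilinear = bilinear_ladd [OF bl] bilinear_radd [OF bl] bilinear_lmul [OF bl]
    bilinear_rmul [OF bl] bilinear_lzero [OF bl] bilinear_rzero [OF bl]
  have *: "quat_eval \<beta>\<^sub>1 \<beta>\<^sub>2 \<psi> (Poly_Mapping.single w r * g)
      = quat_mult \<beta>\<^sub>1 \<beta>\<^sub>2 (quat_eval \<beta>\<^sub>1 \<beta>\<^sub>2 \<psi> (Poly_Mapping.single w r)) (quat_eval \<beta>\<^sub>1 \<beta>\<^sub>2 \<psi> g)" for w r
    using subset_UNIV [of "Poly_Mapping.keys g"]
    by (induction g rule: poly_mapping_induct_keys)
      (simp_all add: distrib_left quat_eval_add mult_single plus_list_def quat_word_append bilinear)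
  show ?thesis
    using subset_UNIV [of "Poly_Mapping.keys f"]
    by (induction f rule: poly_mapping_induct_keys)
      (simp_all only: * distrib_right quat_eval_add bilinear quat_eval_zero mult_zero_left)
qed

lemma quat_eval_hom:
  "quat_eval \<beta>\<^sub>1 \<beta>\<^sub>2 \<psi> \<in> ring_hom (free_algebra V) (quaternion_algebra \<beta>\<^sub>1 \<beta>\<^sub>2)"
proof (rule ring_hom_memI)
  show "quat_eval \<beta>\<^sub>1 \<beta>\<^sub>2 \<psi> \<one>\<^bsub>free_algebra V\<^esub> = \<one>\<^bsub>quaternion_algebra \<beta>\<^sub>1 \<beta>\<^sub>2\<^esub>"
    by (simp add: free_algebra_simps quaternion_algebra_def zero_list_def flip: single_one)
qed (simp_all add: quaternion_algebra_def free_algebra_simps quat_eval_add quat_eval_mult)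

lemma quat_eval_smult:
  "quat_eval \<beta>\<^sub>1 \<beta>\<^sub>2 \<psi> (r \<odot>\<^bsub>free_algebra V\<^esub> f) = r *\<^sub>R quat_eval \<beta>\<^sub>1 \<beta>\<^sub>2 \<psi> f"
  by (simp add: free_algebra_simps quat_eval_mult bilinear_lmul [OF bilinear_quat_mult] quat_mult_table)

section \<open>Clifford algebras of binary diagonal forms\<close>

text \<open>The linear section of the evaluation given by \<open>1, e\<^sub>2, e\<^sub>3, e\<^sub>4 \<mapsto> 1, x, y, x y\<close>; it is not
  multiplicative, but becomes so modulo the Clifford relations.\<close>

definition quat_lift :: "'a \<Rightarrow> 'a \<Rightarrow> real^4 \<Rightarrow> ('a list \<Rightarrow>\<^sub>0 real)" where
  "quat_lift x y c = Poly_Mapping.single [] (c$1) + Poly_Mapping.single [x] (c$2)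
     + Poly_Mapping.single [y] (c$3) + Poly_Mapping.single [x, y] (c$4)"

lemma quat_lift_carrier:
  assumes "x \<in> V" "y \<in> V"
  shows "quat_lift x y c \<in> carrier (free_algebra V)"
proof -
  interpret ring "free_algebra V" by (rule ring_free_algebra)
  have "Poly_Mapping.single w r \<in> carrier (free_algebra V)" if "w \<in> {[], [x], [y], [x, y]}" for w r
    using that assms by (intro single_in_free_algebra) auto
  then have "Poly_Mapping.single [] (c$1) \<oplus>\<^bsub>free_algebra V\<^esub> Poly_Mapping.single [x] (c$2)
     \<oplus>\<^bsub>free_algebra V\<^esub> Poly_Mapping.single [y] (c$3)
     \<oplus>\<^bsub>free_algebra V\<^esub> Poly_Mapping.single [x, y] (c$4) \<in> carrier (free_algebra V)"
    by (intro a_closed) simp_all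
  then show ?thesis
    by (simp add: quat_lift_def free_algebra_simps)
qed

lemma quat_lift_add: "quat_lift x y (c + d) = quat_lift x y c + quat_lift x y d"
  by (simp add: quat_lift_def single_add algebra_simps)

lemma quat_lift_scaleR: "quat_lift x y (r *\<^sub>R c) = Poly_Mapping.single [] r * quat_lift x y c"
  by (simp add: quat_lift_def mult_single plus_list_def distrib_left)

lemma quat_eval_lift:
  assumes "\<psi> x = axis 2 1" "\<psi> y = axis 3 1"
  shows "quat_eval \<beta>\<^sub>1 \<beta>\<^sub>2 \<psi> (quat_lift x y c) = c"
  by (simp add: quat_lift_def quat_eval_add assms quat_mult_table)
    (simp add: vec_eq_iff forall_4 axis_def)

locale binary_diagonal_form =
  fixes x y :: "'a::real_vector" and q :: "'a \<Rightarrow> real" and a b :: real and V :: "'a set"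
  defines "V \<equiv> span {x, y}"
  assumes form: "q (s *\<^sub>R x + t *\<^sub>R y) = a * s\<^sup>2 + b * t\<^sup>2"
begin

abbreviation relation_ideal :: "('a list \<Rightarrow>\<^sub>0 real) set" where
  "relation_ideal \<equiv> Idl\<^bsub>free_algebra V\<^esub> clifford_relations V q"

lemma subspace_V: "subspace V"
  by (simp add: V_def)

lemma mem_V_cases:
  assumes "v \<in> V"
  obtains s t where "v = s *\<^sub>R x + t *\<^sub>R y"
  using assms by (auto simp: V_def span_insert span_singleton algebra_simps)

lemma basis_mem [simp]: "x \<in> V" "y \<in> V"
  by (simp_all add: V_def span_base)

lemma combination_mem [simp]: "s *\<^sub>R x + t *\<^sub>R y \<in> V"
  by (simp add: subspace_V subspace_add subspace_scale)

lemma relation_ideal: "ideal relation_ideal (free_algebra V)"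
  by (rule ring.genideal_ideal [OF ring_free_algebra clifford_relations_carrier [OF subspace_V]])

lemma relation_memI: "f \<in> clifford_relations V q \<Longrightarrow> f \<in> relation_ideal"
  by (simp add: genideal_def) blast

lemma relation_ideal_add: "f \<in> relation_ideal \<Longrightarrow> g \<in> relation_ideal \<Longrightarrow> f + g \<in> relation_ideal"
  using additive_subgroup.a_closed [OF ideal.axioms(1) [OF relation_ideal]]
  by (simp add: free_algebra_simps)

lemma relation_ideal_mult:
  assumes "f \<in> relation_ideal" "g \<in> carrier (free_algebra V)"
  shows "f * g \<in> relation_ideal" "g * f \<in> relation_ideal"
  using ideal.I_l_closed [OF relation_ideal assms] ideal.I_r_closed [OF relation_ideal assms]
  by (simp_all add: free_algebra_simps)

lemma relation_ideal_diff:
  assumes "f \<in> relation_ideal" "g \<in> relation_ideal"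
  shows "f - g \<in> relation_ideal"
proof -
  have "Poly_Mapping.single [] (-1) * g = - g"
    using single_one [where ?'a = "'a list" and ?'b = real]
    by (simp add: single_uminus zero_list_def)
  then have "- g \<in> relation_ideal"
    using relation_ideal_mult(2) [OF assms(2) single_in_free_algebra [of "[]" V "-1"]] by simp
  then show ?thesis
    using relation_ideal_add [OF assms(1)] by fastforce
qed

lemma zero_mem_relation_ideal: "0 \<in> relation_ideal"
  using additive_subgroup.zero_closed [OF ideal.axioms(1) [OF relation_ideal]]
  by (simp add: free_algebra_simps)

abbreviation X :: "'a list \<Rightarrow>\<^sub>0 real" where "X \<equiv> Poly_Mapping.single [x] 1"
abbreviation Y :: "'a list \<Rightarrow>\<^sub>0 real" where "Y \<equiv> Poly_Mapping.single [y] 1"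

lemma basis_carrier [simp]: "X \<in> carrier (free_algebra V)" "Y \<in> carrier (free_algebra V)"
  by (simp_all add: single_in_free_algebra)

lemma combination_relation:
  "Poly_Mapping.single [s *\<^sub>R x + t *\<^sub>R y] 1 - Poly_Mapping.single [x] s - Poly_Mapping.single [y] t
     \<in> relation_ideal"
  by (rule relation_memI, unfold clifford_relations_def linearity_relations_def)
    (use basis_mem in blast)

lemma square_relation:
  "Poly_Mapping.single [s *\<^sub>R x + t *\<^sub>R y, s *\<^sub>R x + t *\<^sub>R y] 1
     - Poly_Mapping.single [] (a * s\<^sup>2 + b * t\<^sup>2) \<in> relation_ideal"
proof (rule relation_memI)
  show "Poly_Mapping.single [s *\<^sub>R x + t *\<^sub>R y, s *\<^sub>R x + t *\<^sub>R y] 1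
     - Poly_Mapping.single [] (a * s\<^sup>2 + b * t\<^sup>2) \<in> clifford_relations V q"
    unfolding clifford_relations_def form [symmetric] using combination_mem by blast
qed

lemma square_basis:
  "X * X - Poly_Mapping.single [] a \<in> relation_ideal"
  "Y * Y - Poly_Mapping.single [] b \<in> relation_ideal"
  using square_relation [of 1 0] square_relation [of 0 1]
  by (simp_all add: mult_single plus_list_def)

text \<open>Polarization: \<open>(x + y)\<^sup>2 = q(x + y) = q(x) + q(y)\<close>, as the form is diagonal.\<close>

lemma anticommute: "X * Y + Y * X \<in> relation_ideal"
proof -
  let ?Z = "Poly_Mapping.single [x + y] 1 :: 'a list \<Rightarrow>\<^sub>0 real"
  have Z: "?Z * ?Z - (Poly_Mapping.single [] a + Poly_Mapping.single [] b) \<in> relation_ideal"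
    using square_relation [of 1 1] by (simp add: mult_single plus_list_def flip: single_add)
  have d: "?Z - X - Y \<in> relation_ideal"
    using combination_relation [of 1 1] by simp
  have ZF: "?Z \<in> carrier (free_algebra V)"
    using combination_mem [of 1 1] by (intro single_in_free_algebra) simp
  have polarization: "f * g + g * f = (h * h - (c + d)) - (f * f - c) - (g * g - d)
      - ((h - f - g) * h + f * (h - f - g) + g * (h - f - g))"
    for f g h c d :: "'a list \<Rightarrow>\<^sub>0 real"
    by (simp add: algebra_simps)
  have "X * Y + Y * X = (?Z * ?Z - (Poly_Mapping.single [] a + Poly_Mapping.single [] b))
      - (X * X - Poly_Mapping.single [] a) - (Y * Y - Poly_Mapping.single [] b)
      - ((?Z - X - Y) * ?Z + X * (?Z - X - Y) + Y * (?Z - X - Y))"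
    by (rule polarization)
  also have "\<dots> \<in> relation_ideal"
    by (intro relation_ideal_diff relation_ideal_add relation_ideal_mult Z d ZF square_basis basis_carrier)
  finally show ?thesis .
qed

text \<open>Modulo the relations, the span of \<open>1, x, y, x y\<close> is stable under left multiplication by vectors,
  which act on it as left multiplication by quaternions. By linearity this only has to be checked for
  \<open>x\<close> and \<open>y\<close>, where it follows from \<open>x x = a\<close>, \<open>y y = b\<close> and \<open>x y = - y x\<close>.\<close>

lemma left_mult_lift:
  fixes s t
  defines "v \<equiv> s *\<^sub>R x + t *\<^sub>R y"
  shows "Poly_Mapping.single [v] 1 * quat_lift x y c
     - quat_lift x y (quat_mult (-a) (-b) (s *\<^sub>R axis 2 1 + t *\<^sub>R axis 3 1) c) \<in> relation_ideal"
proof -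
  let ?s = "\<lambda>r. Poly_Mapping.single [] r :: 'a list \<Rightarrow>\<^sub>0 real"
  let ?L = "\<lambda>f c. f * quat_lift x y c"
  have sF: "?s r \<in> carrier (free_algebra V)" for r
    by (simp add: single_in_free_algebra)
  (* The coefficients of 1 and y cancel; those of x and x y leave multiples of x x - a. *)
  have "?L X c - quat_lift x y (quat_mult (-a) (-b) (axis 2 1) c)
      = ?s (c$2) * (X * X - ?s a) + (?s (c$4) * (X * X - ?s a)) * Y"
    by (simp add: quat_lift_def quat_mult_def axis_def distrib_left left_diff_distrib right_diff_distrib
        mult_single plus_list_def mult.commute)
  then have LX: "?L X c - quat_lift x y (quat_mult (-a) (-b) (axis 2 1) c) \<in> relation_ideal"
    by (simp only: relation_ideal_add relation_ideal_mult square_basis sF basis_carrier)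
  (* In the last term, y x y + b x = (x y + y x) y - x (y y - b). *)
  have "?L Y c - quat_lift x y (quat_mult (-a) (-b) (axis 3 1) c)
      = ?s (c$2) * (X * Y + Y * X) + ?s (c$3) * (Y * Y - ?s b)
        + ?s (c$4) * ((X * Y + Y * X) * Y - X * (Y * Y - ?s b))"
    by (simp add: quat_lift_def quat_mult_def axis_def distrib_left distrib_right left_diff_distrib right_diff_distrib
        mult_single plus_list_def mult.commute single_uminus)
  then have LY: "?L Y c - quat_lift x y (quat_mult (-a) (-b) (axis 3 1) c) \<in> relation_ideal"
    by (simp only: relation_ideal_add relation_ideal_diff relation_ideal_mult square_basis anticommute sF basis_carrier)
  have "quat_lift x y (quat_mult (-a) (-b) (s *\<^sub>R axis 2 1 + t *\<^sub>R axis 3 1) c)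
      = ?s s * quat_lift x y (quat_mult (-a) (-b) (axis 2 1) c)
        + ?s t * quat_lift x y (quat_mult (-a) (-b) (axis 3 1) c)"
    by (simp only: bilinear_ladd [OF bilinear_quat_mult] bilinear_lmul [OF bilinear_quat_mult]
        quat_lift_add quat_lift_scaleR)
  moreover have "Poly_Mapping.single [x] s = ?s s * X" "Poly_Mapping.single [y] t = ?s t * Y"
    by (simp_all add: mult_single plus_list_def)
  ultimately have "Poly_Mapping.single [v] 1 * quat_lift x y c
     - quat_lift x y (quat_mult (-a) (-b) (s *\<^sub>R axis 2 1 + t *\<^sub>R axis 3 1) c)
     = (Poly_Mapping.single [v] 1 - Poly_Mapping.single [x] s - Poly_Mapping.single [y] t) * quat_lift x y c
       + ?s s * (?L X c - quat_lift x y (quat_mult (-a) (-b) (axis 2 1) c))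
       + ?s t * (?L Y c - quat_lift x y (quat_mult (-a) (-b) (axis 3 1) c))"
    by (simp add: algebra_simps)
  then show ?thesis
    using LX LY combination_relation [of s t]
    by (simp only: v_def relation_ideal_add relation_ideal_mult sF quat_lift_carrier basis_mem)
qed

text \<open>Since the section is linear, it suffices to consider words, and these are reduced letter by
  letter from the left with the preceding lemma.\<close>

lemma eval_lift_congruent:
  assumes \<psi>: "linear \<psi>" "\<psi> x = axis 2 1" "\<psi> y = axis 3 1"
    and f: "f \<in> carrier (free_algebra V)"
  shows "f - quat_lift x y (quat_eval (-a) (-b) \<psi> f) \<in> relation_ideal"
proof -
  let ?h = "quat_eval (-a) (-b) \<psi>"
  let ?good = "\<lambda>f. f - quat_lift x y (?h f) \<in> relation_ideal"
  have word: "?good (Poly_Mapping.single w 1)" if "w \<in> lists V" for w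
    using that
  proof (induction w)
    case Nil
    then show ?case
      using zero_mem_relation_ideal by (simp add: quat_lift_def axis_def)
  next
    case (Cons v w)
    from \<open>v \<in> V\<close> obtain s t where v: "v = s *\<^sub>R x + t *\<^sub>R y"
      by (rule mem_V_cases)
    have \<psi>v: "\<psi> v = s *\<^sub>R axis 2 1 + t *\<^sub>R axis 3 1"
      by (simp add: v linear_add [OF \<psi>(1)] linear_scale [OF \<psi>(1)] \<psi>)
    let ?v = "Poly_Mapping.single [v] 1 :: 'a list \<Rightarrow>\<^sub>0 real"
    let ?w = "Poly_Mapping.single w 1 :: 'a list \<Rightarrow>\<^sub>0 real"
    have vw: "Poly_Mapping.single (v # w) 1 = ?v * ?w"
      by (simp add: mult_single plus_list_def)
    have "?v * ?w - quat_lift x y (?h (?v * ?w)) = ?v * (?w - quat_lift x y (?h ?w))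
        + (?v * quat_lift x y (?h ?w) - quat_lift x y (quat_mult (-a) (-b) (\<psi> v) (?h ?w)))"
      by (simp add: quat_eval_mult quat_mult_table right_diff_distrib)
    also have "\<dots> \<in> relation_ideal"
      using Cons left_mult_lift [of s t "?h ?w"]
      unfolding \<psi>v by (intro relation_ideal_add relation_ideal_mult single_in_free_algebra) (auto simp: v)
    finally show ?case
      unfolding vw .
  qed
  have "Poly_Mapping.keys f \<subseteq> lists V"
    using f by (simp add: free_algebra_def)
  then show ?thesis
  proof (induction f rule: poly_mapping_induct_keys)
    case zero
    then show ?case
      using zero_mem_relation_ideal by (simp add: quat_lift_def)
  next
    case (single w r)
    let ?w = "Poly_Mapping.single w 1 :: 'a list \<Rightarrow>\<^sub>0 real"
    have "Poly_Mapping.single w r - quat_lift x y (?h (Poly_Mapping.single w r))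
        = Poly_Mapping.single [] r * (?w - quat_lift x y (?h ?w))"
      by (simp add: mult_single plus_list_def right_diff_distrib quat_lift_scaleR)
    then show ?case
      using relation_ideal_mult(2) [OF word [OF single] single_in_free_algebra [of "[]" V r]] by simp
  next
    case (add f g)
    then show ?case
      using relation_ideal_add [OF add] by (simp add: quat_eval_add quat_lift_add algebra_simps)
  qed
qed

theorem clifford_algebra_isomorphic:
  assumes "independent {x, y}" "x \<noteq> y"
  shows "clifford_algebra V q \<simeq>\<^sub>a quaternion_algebra (-a) (-b)"
proof -
  let ?F = "free_algebra V" and ?H = "quaternion_algebra (-a) (-b)"
  obtain \<psi> :: "'a \<Rightarrow> real^4" where \<psi>: "linear \<psi>" "\<psi> x = axis 2 1" "\<psi> y = axis 3 1"
    using linear_independent_extend [OF assms(1), of "\<lambda>v. if v = x then axis 2 1 else axis 3 1"] assms(2)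
    by auto
  let ?h = "quat_eval (-a) (-b) \<psi>"
  have \<psi>_V: "\<psi> (s *\<^sub>R x + t *\<^sub>R y) = s *\<^sub>R axis 2 1 + t *\<^sub>R axis 3 1" for s t
    by (simp add: linear_add [OF \<psi>(1)] linear_scale [OF \<psi>(1)] \<psi>)
  interpret h: ring_hom_ring ?F ?H ?h
    by (rule ring_hom_ringI2 [OF ring_free_algebra ring_quaternion_algebra quat_eval_hom])
  have square: "quat_mult (-a) (-b) (\<psi> v) (\<psi> v) = q v *\<^sub>R axis 1 1" if "v \<in> V" for v
    using that
  proof (rule mem_V_cases)
    fix s t assume v: "v = s *\<^sub>R x + t *\<^sub>R y"
    show ?thesis
      unfolding v \<psi>_V form
      by (simp add: quat_mult_def vec_eq_iff forall_4 axis_def power2_eq_square)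
  qed
  have zero: "\<zero>\<^bsub>?H\<^esub> = 0"
    by (simp add: quaternion_algebra_def)
  have relations: "?h g = 0" if "g \<in> clifford_relations V q" for g
    using that unfolding clifford_relations_def
  proof
    assume "g \<in> linearity_relations V"
    then obtain r s u v where "g = Poly_Mapping.single [r *\<^sub>R u + s *\<^sub>R v] 1
        - Poly_Mapping.single [u] r - Poly_Mapping.single [v] s"
      unfolding linearity_relations_def by blast
    then show ?thesis
      by (simp add: quat_eval_diff quat_mult_table linear_add [OF \<psi>(1)] linear_scale [OF \<psi>(1)])
  next
    assume "g \<in> {Poly_Mapping.single [v, v] 1 - Poly_Mapping.single [] (q v) | v. v \<in> V}"
    then obtain v where "v \<in> V" "g = Poly_Mapping.single [v, v] 1 - Poly_Mapping.single [] (q v)"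
      by blast
    then show ?thesis
      by (simp add: quat_eval_diff quat_mult_table square)
  qed
  have kernel: "relation_ideal \<subseteq> a_kernel ?F ?H ?h"
  proof (rule ring.genideal_minimal [OF ring_free_algebra h.kernel_is_ideal], rule subsetI)
    fix g assume g: "g \<in> clifford_relations V q"
    show "g \<in> a_kernel ?F ?H ?h"
      unfolding a_kernel_def' zero
      using relations [OF g] subsetD [OF clifford_relations_carrier [OF subspace_V] g] by simp
  qed
  show ?thesis
  proof (rule algebra_isomorphic_if_common_kernel)
    show "clifford_projection V q f = \<zero>\<^bsub>clifford_algebra V q\<^esub> \<longleftrightarrow> ?h f = \<zero>\<^bsub>?H\<^esub>"
      if f: "f \<in> carrier ?F" for f
    proof -
      have "f \<in> relation_ideal" if "?h f = 0"
        using eval_lift_congruent [OF \<psi> f] that by (simp add: quat_lift_def)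
      then show ?thesis
        using kernel unfolding clifford_projection_eq_zero_iff [OF subspace_V f] a_kernel_def' zero
        by blast
    qed
    show "?h ` carrier ?F = carrier ?H"
    proof
      show "carrier ?H \<subseteq> ?h ` carrier ?F"
      proof
        fix c
        have "c = ?h (quat_lift x y c)"
          by (rule quat_eval_lift [where \<psi> = \<psi>, OF \<psi>(2,3), symmetric])
        then show "c \<in> ?h ` carrier ?F"
          using quat_lift_carrier [OF basis_mem] by blast
      qed
    qed (auto simp: quaternion_algebra_def)
    show "?h (r \<odot>\<^bsub>?F\<^esub> f) = r \<odot>\<^bsub>?H\<^esub> ?h f" for r f
      by (simp add: quat_eval_smult quaternion_algebra_def)
  qed (simp_all add: subspace_V ring_free_algebra ring_clifford_algebra ring_quaternion_algebra
      clifford_projection_hom clifford_projection_surj clifford_projection_smult quat_eval_hom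
      smult_free_algebra_closed)
qed

end

section \<open>Real quaternion algebras up to isomorphism\<close>

text \<open>\<open>s e\<^sub>2\<close> and \<open>t e\<^sub>3\<close> satisfy the defining relations for \<open>s\<^sup>2 \<beta>\<^sub>1\<close> and \<open>t\<^sup>2 \<beta>\<^sub>2\<close>, and their product is
  \<open>s t e\<^sub>4\<close>.\<close>

lemma quaternion_algebra_rescale:
  assumes "s \<noteq> 0" "t \<noteq> 0"
  shows "quaternion_algebra (s\<^sup>2 * \<beta>\<^sub>1) (t\<^sup>2 * \<beta>\<^sub>2) \<simeq>\<^sub>a quaternion_algebra \<beta>\<^sub>1 \<beta>\<^sub>2"
proof -
  define h :: "real^4 \<Rightarrow> real^4" where "h v = vector [v$1, s * v$2, t * v$3, s * t * v$4]" for v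
  define g :: "real^4 \<Rightarrow> real^4" where "g v = vector [v$1, v$2 / s, v$3 / t, v$4 / (s * t)]" for v
  have "bij h"
    by (rule o_bij [of g]) (simp_all add: h_def g_def fun_eq_iff vec_eq_iff forall_4 assms)
  then have "h \<in> ring_iso (quaternion_algebra (s\<^sup>2 * \<beta>\<^sub>1) (t\<^sup>2 * \<beta>\<^sub>2)) (quaternion_algebra \<beta>\<^sub>1 \<beta>\<^sub>2)"
    by (intro ring_iso_memI)
      (simp_all add: quaternion_algebra_def h_def quat_mult_def vec_eq_iff forall_4 axis_def
        power2_eq_square algebra_simps)
  moreover have "h (r *\<^sub>R v) = r *\<^sub>R h v" for r v
    by (simp add: h_def vec_eq_iff forall_4)
  ultimately show ?thesis
    unfolding algebra_isomorphic_def by (auto simp: quaternion_algebra_def)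
qed

lemma division_quaternion_algebra_no_zero_divisors:
  assumes "division_algebra (quaternion_algebra \<beta>\<^sub>1 \<beta>\<^sub>2)" "quat_mult \<beta>\<^sub>1 \<beta>\<^sub>2 u v = 0"
  shows "u = 0 \<or> v = 0"
proof (rule disjCI)
  assume "v \<noteq> 0"
  let ?H = "quaternion_algebra \<beta>\<^sub>1 \<beta>\<^sub>2"
  interpret H: ring ?H by (rule ring_quaternion_algebra)
  have carrier: "u \<in> carrier ?H" "v \<in> carrier ?H"
    by (simp_all add: quaternion_algebra_def)
  have unit: "v \<in> Units ?H"
    using assms(1) \<open>v \<noteq> 0\<close> by (auto simp: division_algebra_def quaternion_algebra_def)
  have "u = u \<otimes>\<^bsub>?H\<^esub> v \<otimes>\<^bsub>?H\<^esub> inv\<^bsub>?H\<^esub> v"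
    using carrier unit by (simp add: H.m_assoc)
  also have "u \<otimes>\<^bsub>?H\<^esub> v = \<zero>\<^bsub>?H\<^esub>"
    using assms(2) by (simp add: quaternion_algebra_def)
  also have "\<zero>\<^bsub>?H\<^esub> \<otimes>\<^bsub>?H\<^esub> inv\<^bsub>?H\<^esub> v = \<zero>\<^bsub>?H\<^esub>"
    using unit by simp
  finally show "u = 0"
    by (simp add: quaternion_algebra_def)
qed

text \<open>Otherwise the norm has an isotropic vector \<open>\<surd>(-\<beta>\<^sub>i) + e\<close>, with \<open>e = e\<^sub>2\<close> or \<open>e = e\<^sub>3\<close>, and this
  vector times its conjugate is \<open>0\<close>.\<close>

lemma division_quaternion_algebra_pos:
  assumes "division_algebra (quaternion_algebra \<beta>\<^sub>1 \<beta>\<^sub>2)"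
  shows "\<beta>\<^sub>1 > 0" "\<beta>\<^sub>2 > 0"
proof -
  note zero = division_quaternion_algebra_no_zero_divisors [OF assms]
  show "\<beta>\<^sub>1 > 0"
  proof (rule ccontr)
    assume "\<not> \<beta>\<^sub>1 > 0"
    then have "quat_mult \<beta>\<^sub>1 \<beta>\<^sub>2 (vector [sqrt (- \<beta>\<^sub>1), 1, 0, 0]) (vector [sqrt (- \<beta>\<^sub>1), -1, 0, 0]) = 0"
      by (simp add: quat_mult_def vec_eq_iff forall_4)
    from zero [OF this] show False
      by (simp add: vec_eq_iff forall_4)
  qed
  show "\<beta>\<^sub>2 > 0"
  proof (rule ccontr)
    assume "\<not> \<beta>\<^sub>2 > 0"
    then have "quat_mult \<beta>\<^sub>1 \<beta>\<^sub>2 (vector [sqrt (- \<beta>\<^sub>2), 0, 1, 0]) (vector [sqrt (- \<beta>\<^sub>2), 0, -1, 0]) = 0"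
      by (simp add: quat_mult_def vec_eq_iff forall_4)
    from zero [OF this] show False
      by (simp add: vec_eq_iff forall_4)
  qed
qed

section \<open>Fibonacci quaternions\<close>

lemma independent_fib_quat:
  "independent {fib_quat n, fib_quat (n+1)}" "fib_quat n \<noteq> fib_quat (n+1)"
proof -
  show ne: "fib_quat n \<noteq> fib_quat (n+1)"
    using fib_quat_independent [of 1 n 0 0 1] by auto
  have "fib_quat (n+1) \<noteq> 0"
    using fib_quat_independent [of 0 n 1 0 0] by auto
  moreover have "fib_quat n \<notin> span {fib_quat (n+1)}"
    using fib_quat_independent [of 1 n 0 0] by (auto simp: span_singleton)
  ultimately show "independent {fib_quat n, fib_quat (n+1)}"
    using ne by (simp add: independent_insert)
qed

lemma quat_norm_fib_quat_pos:
  assumes "\<beta>\<^sub>1 > 0" "\<beta>\<^sub>2 > 0"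
  shows "quat_norm \<beta>\<^sub>1 \<beta>\<^sub>2 (fib_quat n) > 0"
proof -
  have "fib (n + 1) > 0"
    by (simp add: fib_neq_0_nat)
  (* The second coordinate is the first one that is nonzero for every n, as fib 0 = 0. *)
  then have "0 < (real (fib n))\<^sup>2 + \<beta>\<^sub>1 * (real (fib (n+1)))\<^sup>2"
    using assms(1) by (intro add_nonneg_pos) simp_all
  then show ?thesis
    using assms by (simp add: quat_norm_def fib_quat_def add_pos_nonneg)
qed

theorem theorem3p4:
  fixes \<beta>\<^sub>1 \<beta>\<^sub>2 :: real
  assumes "division_algebra (quaternion_algebra \<beta>\<^sub>1 \<beta>\<^sub>2)"
  shows "\<exists>n'::nat. \<forall>n\<ge>n'.
           clifford_algebra (fib_space n) (fib_form \<beta>\<^sub>1 \<beta>\<^sub>2 n) \<simeq>\<^sub>a quaternion_algebra (-1) (-1)"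
proof (intro exI allI impI)
  fix n :: nat assume "0 \<le> n"
  let ?N = "\<lambda>k. quat_norm \<beta>\<^sub>1 \<beta>\<^sub>2 (fib_quat k)"
  have pos: "?N k > 0" for k
    using quat_norm_fib_quat_pos division_quaternion_algebra_pos [OF assms] by blast
  interpret binary_diagonal_form "fib_quat n" "fib_quat (n+1)" "fib_form \<beta>\<^sub>1 \<beta>\<^sub>2 n"
    "?N n" "?N (n+1)" "fib_space n"
    by unfold_locales (simp_all only: fib_space_eq_span fib_form_coordinates)
  have "clifford_algebra (fib_space n) (fib_form \<beta>\<^sub>1 \<beta>\<^sub>2 n) \<simeq>\<^sub>a quaternion_algebra (- ?N n) (- ?N (n+1))"
    by (rule clifford_algebra_isomorphic [OF independent_fib_quat])
  moreover have "quaternion_algebra (- ?N n) (- ?N (n+1)) \<simeq>\<^sub>a quaternion_algebra (-1) (-1)"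
    using quaternion_algebra_rescale [of "sqrt (?N n)" "sqrt (?N (n+1))" "-1" "-1"] pos [of n] pos [of "n+1"]
    by simp
  ultimately show "clifford_algebra (fib_space n) (fib_form \<beta>\<^sub>1 \<beta>\<^sub>2 n) \<simeq>\<^sub>a quaternion_algebra (-1) (-1)"
    by (rule algebra_isomorphic_trans)
qed

end
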